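(* Let a linear systematic vector $[n=k+r,k]$ MDS code (the base code), with $\mu$ symbols per node over a finite field, be given together with a linear repair scheme for its systematic nodes in which, for each failed systematic node $i\in\{1,\ldots,k\}$, all parity nodes pass the same linear combination of their data, i.e. there are matrices $Q_i$ such that parity node $(k+j)$ passes $\mathbf a^TP_jQ_i$ for every $j\in\{1,\ldots,r\}$. Let $$g=\left\lfloor\frac r{\sqrt{k+1}}\right\rfloor,$$ and assume $g\ge1$ and $g$ divides $r$. Then there is a code obtained by piggybacking two instances of the base code (hence over the same field, with $2\mu$ symbols per node and $2k\mu$ message symbols) such that: (i) it is an $[n,k]$ MDS code; (ii) each systematic node can be repaired with the same amounts of data read and downloaded as those used by the given repair scheme of the base code applied to two instances; (iii) the parity nodes can be repaired with an average amount of data read and downloaded, as a fraction of the message size $2k\mu$, equal to $$\frac12+\frac{k+\left(\frac rg-1\right)^2}{2k\left(\frac rg\right)} .$$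
   Context: Base code: the message is $\mathbf a=[\mathbf a_1^T\ \cdots\ \mathbf a_k^T]^T$ with each $\mathbf a_i$ a vector of length $\mu$ over the field. Systematic node $i\in\{1,\ldots,k\}$ stores $\mathbf a_i^T$; parity node $(k+j)$, $j\in\{1,\ldots,r\}$, stores $\mathbf a^TP_j$ for some $(k\mu\times\mu)$ matrix $P_j$. MDS means that the message can be recovered from the contents of any $k$ of the $n$ nodes. A linear repair scheme for systematic node $i$: each surviving node passes a fixed linear function of its data, and $\mathbf a_i$ can be recovered from what is passed. The amount of data read is the total number of stored symbols accessed at the surviving nodes; the amount downloaded is the total number of symbols passed by them. Piggybacking two instances with messages $\mathbf a,\mathbf b$: each node stores its base-code data for $\mathbf a$, and its base-code data for $\mathbf b$ plus an arbitrary function (a length-$\mu$ vector, depending on the node) of $\mathbf a$; optionally an invertible linear transformation is applied to the data of each node. *)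

theory Defs
  imports Complex_Main "HOL-Library.FuncSet" "Jordan_Normal_Form.Matrix"
begin

(* A code is given by its storage map: C l m is the vector stored by node l when the message is m.
   All indices start at 0: systematic nodes are 0, ..., k - 1, parity nodes are k, ..., k + r - 1. *)
type_synonym 'a code = "nat \<Rightarrow> 'a vec \<Rightarrow> 'a vec"

(* The row vector v^T A, as a vector. *)
definition vec_mat_mult :: "'a :: comm_semiring_0 vec \<Rightarrow> 'a mat \<Rightarrow> 'a vec" where
  "vec_mat_mult v A = transpose_mat A *\<^sub>v v"

(* The block a_l of the message occupies positions l * \<mu>, ..., l * \<mu> + \<mu> - 1 of a. *)
definition systematic_code :: "nat \<Rightarrow> nat \<Rightarrow> (nat \<Rightarrow> 'a :: comm_semiring_0 mat) \<Rightarrow> 'a code" where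
  "systematic_code k \<mu> P l a =
     (if l < k then vec \<mu> (\<lambda>t. a $ (l * \<mu> + t)) else vec_mat_mult a (P (l - k)))"

definition recoverable :: "'m set \<Rightarrow> ('m \<Rightarrow> 'd) \<Rightarrow> ('m \<Rightarrow> 'x) \<Rightarrow> bool" where
  "recoverable Msgs seen target \<longleftrightarrow> (\<exists>decode. \<forall>m\<in>Msgs. decode (seen m) = target m)"

definition mds_code :: "nat \<Rightarrow> nat \<Rightarrow> nat \<Rightarrow> 'a code \<Rightarrow> bool" where
  "mds_code n k \<mu> C \<longleftrightarrow>
     (\<forall>l<n. \<forall>m\<in>carrier_vec (k * \<mu>). C l m \<in> carrier_vec \<mu>) \<and>
     (\<forall>S. S \<subseteq> {..<n} \<and> card S = k \<longrightarrow>
        recoverable (carrier_vec (k * \<mu>)) (\<lambda>m. \<lambda>l\<in>S. C l m) (\<lambda>m. m))"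

(* Each surviving node l passes (C l m)^T (M l). The number of columns of M l may depend on l,
   and it is 0 when the node passes nothing. *)
definition linear_repair ::
  "nat \<Rightarrow> nat \<Rightarrow> nat \<Rightarrow> 'a :: comm_semiring_0 code \<Rightarrow> nat \<Rightarrow> (nat \<Rightarrow> 'a mat) \<Rightarrow> bool" where
  "linear_repair n k \<mu> C failed M \<longleftrightarrow>
     (\<forall>l\<in>{..<n} - {failed}. dim_row (M l) = \<mu>) \<and>
     recoverable (carrier_vec (k * \<mu>))
       (\<lambda>m. \<lambda>l\<in>{..<n} - {failed}. vec_mat_mult (C l m) (M l)) (C failed)"

(* Stored symbol t of node l is accessed iff row t of M l is nonzero. *)
definition amount_read :: "nat \<Rightarrow> nat \<Rightarrow> (nat \<Rightarrow> 'a :: zero mat) \<Rightarrow> nat" where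
  "amount_read n failed M =
     (\<Sum>l\<in>{..<n} - {failed}. card {t. t < dim_row (M l) \<and> row (M l) t \<noteq> 0\<^sub>v (dim_col (M l))})"

definition amount_downloaded :: "nat \<Rightarrow> nat \<Rightarrow> (nat \<Rightarrow> 'a mat) \<Rightarrow> nat" where
  "amount_downloaded n failed M = (\<Sum>l\<in>{..<n} - {failed}. dim_col (M l))"

(* C' is obtained by piggybacking two instances of C, with messages a and b; the message of C' is
   the concatenation of a and b. The piggyback p l is an arbitrary function, not necessarily linear;
   T l is the invertible transformation applied at node l (the identity if none is applied). *)
definition piggybacked :: "nat \<Rightarrow> nat \<Rightarrow> nat \<Rightarrow> 'a :: comm_ring_1 code \<Rightarrow> 'a code \<Rightarrow> bool" where
  "piggybacked n k \<mu> C C' \<longleftrightarrow> (\<exists>p T.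
     (\<forall>l<n. \<forall>a\<in>carrier_vec (k * \<mu>). p l a \<in> carrier_vec \<mu>) \<and>
     (\<forall>l<n. T l \<in> carrier_mat (2 * \<mu>) (2 * \<mu>) \<and> invertible_mat (T l)) \<and>
     (\<forall>l<n. \<forall>a\<in>carrier_vec (k * \<mu>). \<forall>b\<in>carrier_vec (k * \<mu>).
        C' l (a @\<^sub>v b) = T l *\<^sub>v (C l a @\<^sub>v (C l b + p l a))))"

end

(* Split the parities into g groups of size s = r / g. The first parity of each group, its head,
   adds to its symbols for b the sum of the symbols for a of the s - 1 others.
   - Any k nodes yield a from the first instance, hence the piggybacks, hence b.
   - A systematic node is repaired by applying the base scheme to both halves: because the parities
     pass the same combination, the first half reveals the image of each piggyback under it.
   - A parity that is not a head is repaired from the b-halves of the systematic nodes and of its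
     head, and the a-halves of the rest of its group: k + s - 1 half-nodes instead of the 2 k read
     for a head. *)
theory Submission
  imports Defs
begin

section \<open>Recoverability as injectivity on messages\<close>

text \<open>A decoder exists exactly when the target factors through what is seen. This removes
  decoders from all later arguments: it suffices to compare two messages with the same
  observations.\<close>

lemma recoverable_restrict_iff:
  "recoverable Msgs (\<lambda>m. \<lambda>l\<in>S. f l m) target \<longleftrightarrow>
     (\<forall>m\<in>Msgs. \<forall>m'\<in>Msgs. (\<forall>l\<in>S. f l m = f l m') \<longrightarrow> target m = target m')"
proof
  assume "recoverable Msgs (\<lambda>m. \<lambda>l\<in>S. f l m) target"
  then obtain decode where decode: "\<forall>m\<in>Msgs. decode (\<lambda>l\<in>S. f l m) = target m"
    unfolding recoverable_def by blast
  have "(\<lambda>l\<in>S. f l m) = (\<lambda>l\<in>S. f l m')" if "\<forall>l\<in>S. f l m = f l m'" for m m'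
    using that by (auto intro: restrict_ext)
  then show "\<forall>m\<in>Msgs. \<forall>m'\<in>Msgs. (\<forall>l\<in>S. f l m = f l m') \<longrightarrow> target m = target m'"
    using decode by metis
next
  assume inj: "\<forall>m\<in>Msgs. \<forall>m'\<in>Msgs. (\<forall>l\<in>S. f l m = f l m') \<longrightarrow> target m = target m'"
  \<comment> \<open>The decoder picks any message consistent with the observation. It may differ
    from the true one, but by \<open>inj\<close> both have the same target.\<close>
  define decode where
    "decode x = target (SOME m. m \<in> Msgs \<and> (\<lambda>l\<in>S. f l m) = x)" for x
  have "decode (\<lambda>l\<in>S. f l m) = target m" if m: "m \<in> Msgs" for m
  proof -
    define m' where "m' = (SOME m'. m' \<in> Msgs \<and> (\<lambda>l\<in>S. f l m') = (\<lambda>l\<in>S. f l m))"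
    have m': "m' \<in> Msgs" "(\<lambda>l\<in>S. f l m') = (\<lambda>l\<in>S. f l m)"
      using someI[of "\<lambda>m'. m' \<in> Msgs \<and> (\<lambda>l\<in>S. f l m') = (\<lambda>l\<in>S. f l m)" m] m
      unfolding m'_def by auto
    have "\<forall>l\<in>S. f l m' = f l m"
      using m'(2) by (metis restrict_apply')
    then show ?thesis
      using inj m m'(1) unfolding decode_def m'_def by blast
  qed
  then show "recoverable Msgs (\<lambda>m. \<lambda>l\<in>S. f l m) target"
    unfolding recoverable_def by blast
qed

lemma mds_code_carrier:
  assumes "mds_code n k \<mu> C" "l < n" "m \<in> carrier_vec (k * \<mu>)"
  shows "C l m \<in> carrier_vec \<mu>"
  using assms unfolding mds_code_def by blast

lemma mds_code_inj:
  assumes "mds_code n k \<mu> C" "S \<subseteq> {..<n}" "card S = k"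
    and "m \<in> carrier_vec (k * \<mu>)" "m' \<in> carrier_vec (k * \<mu>)" "\<And>l. l \<in> S \<Longrightarrow> C l m = C l m'"
  shows "m = m'"
  using assms unfolding mds_code_def recoverable_restrict_iff by blast

lemma linear_repair_inj:
  assumes "linear_repair n k \<mu> C failed M"
    and "m \<in> carrier_vec (k * \<mu>)" "m' \<in> carrier_vec (k * \<mu>)"
    and "\<And>l. l < n \<Longrightarrow> l \<noteq> failed \<Longrightarrow> vec_mat_mult (C l m) (M l) = vec_mat_mult (C l m') (M l)"
  shows "C failed m = C failed m'"
  using assms unfolding linear_repair_def recoverable_restrict_iff by blast

section \<open>Linear maps applied by the nodes, and windows\<close>

lemma dim_vec_mat_mult [simp]: "dim_vec (vec_mat_mult v A) = dim_col A"
  by (simp add: vec_mat_mult_def)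

lemma index_vec_mat_mult:
  assumes "v \<in> carrier_vec (dim_row A)" "c < dim_col A"
  shows "vec_mat_mult v A $ c = (\<Sum>t<dim_row A. A $$ (t, c) * v $ t)"
  using assms by (simp add: vec_mat_mult_def scalar_prod_def atLeast0LessThan)

lemma vec_mat_mult_add:
  assumes "v \<in> carrier_vec (dim_row A)" "w \<in> carrier_vec (dim_row A)"
  shows "vec_mat_mult (v + w) A = vec_mat_mult v A + vec_mat_mult w A"
  unfolding vec_mat_mult_def
  by (rule mult_add_distrib_mat_vec[of _ "dim_col A" "dim_row A"]) (use assms in auto)

text \<open>The columns are consecutive unit vectors, so a node using this matrix passes
  \<open>d\<close> of its \<open>N\<close> symbols unchanged, starting at position
  \<open>off\<close>. Width \<open>d = 0\<close> encodes a node that passes nothing.\<close>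

definition window :: "nat \<Rightarrow> nat \<Rightarrow> nat \<Rightarrow> 'a :: {zero, one} mat" where
  "window N off d = mat N d (\<lambda>(t, c). if t = off + c then 1 else 0)"

lemma dim_window [simp]: "dim_row (window N off d) = N" "dim_col (window N off d) = d"
  by (simp_all add: window_def)

lemma vec_mat_mult_window:
  fixes v :: "'a :: comm_semiring_1 vec"
  assumes v: "v \<in> carrier_vec N" and le: "off + d \<le> N"
  shows "vec_mat_mult v (window N off d) = vec d (\<lambda>c. v $ (off + c))"
proof (rule eq_vecI)
  fix c assume "c < dim_vec (vec d (\<lambda>c. v $ (off + c)))"
  then have c: "c < d" by simp
  have "vec_mat_mult v (window N off d) $ c = (\<Sum>t<N. (if t = off + c then 1 else 0) * v $ t)"
    using v c by (subst index_vec_mat_mult) (auto simp: window_def intro!: sum.cong)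
  also have "\<dots> = (\<Sum>t<N. if off + c = t then v $ t else 0)"
    by (intro sum.cong) auto
  also have "\<dots> = v $ (off + c)"
    using c le by (simp add: sum.delta)
  finally show "vec_mat_mult v (window N off d) $ c = vec d (\<lambda>c. v $ (off + c)) $ c"
    using c by simp
qed simp

lemma vec_mat_mult_window_append:
  fixes u w :: "'a :: comm_semiring_1 vec"
  assumes "u \<in> carrier_vec d" "w \<in> carrier_vec d"
  shows "vec_mat_mult (u @\<^sub>v w) (window (2 * d) 0 d) = u"
    and "vec_mat_mult (u @\<^sub>v w) (window (2 * d) d d) = w"
proof -
  have c: "u @\<^sub>v w \<in> carrier_vec (2 * d)"
    using append_carrier_vec[OF assms] by (simp add: mult_2)
  show "vec_mat_mult (u @\<^sub>v w) (window (2 * d) 0 d) = u"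
    by (rule eq_vecI) (use assms in \<open>simp_all add: vec_mat_mult_window[OF c]\<close>)
  show "vec_mat_mult (u @\<^sub>v w) (window (2 * d) d d) = w"
    by (rule eq_vecI) (use assms in \<open>simp_all add: vec_mat_mult_window[OF c]\<close>)
qed

lemma card_nonzero_rows_window:
  assumes "off + d \<le> N"
  shows "card {t. t < dim_row (window N off d :: 'a :: zero_neq_one mat) \<and>
    row (window N off d :: 'a mat) t \<noteq> 0\<^sub>v (dim_col (window N off d :: 'a mat))} = d"
proof -
  have "{t. t < dim_row (window N off d :: 'a mat) \<and>
    row (window N off d :: 'a mat) t \<noteq> 0\<^sub>v (dim_col (window N off d :: 'a mat))} = {off..<off + d}"
  proof (intro Set.set_eqI iffI)
    fix t assume "t \<in> {t. t < dim_row (window N off d :: 'a mat) \<and>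
      row (window N off d :: 'a mat) t \<noteq> 0\<^sub>v (dim_col (window N off d :: 'a mat))}"
    then have t: "t < N" "row (window N off d :: 'a mat) t \<noteq> 0\<^sub>v d" by auto
    then obtain c where "c < d" "row (window N off d :: 'a mat) t $ c \<noteq> 0"
      by (metis dim_window(2) eq_vecI index_row(2) index_zero_vec)
    then show "t \<in> {off..<off + d}"
      using t(1) by (auto simp: window_def split: if_splits)
  next
    fix t assume t: "t \<in> {off..<off + d}"
    then have "row (window N off d :: 'a mat) t $ (t - off) = 1"
      using assms by (auto simp: window_def)
    moreover have "(0\<^sub>v d :: 'a vec) $ (t - off) = 0" using t by auto
    ultimately have "row (window N off d :: 'a mat) t \<noteq> 0\<^sub>v d" by auto
    then show "t \<in> {t. t < dim_row (window N off d :: 'a mat) \<and>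
      row (window N off d :: 'a mat) t \<noteq> 0\<^sub>v (dim_col (window N off d :: 'a mat))}"
      using t assms by auto
  qed
  then show ?thesis by simp
qed

text \<open>A window that fits inside the node has one nonzero row per column, so reading costs as
  much as downloading. One computation therefore serves both averages for the parity nodes.\<close>

lemma amount_window:
  assumes "\<And>l. l < n \<Longrightarrow> off l + d l \<le> N"
  shows "amount_read n failed (\<lambda>l. window N (off l) (d l) :: 'a :: zero_neq_one mat) =
      (\<Sum>l\<in>{..<n} - {failed}. d l)"
    and "amount_downloaded n failed (\<lambda>l. window N (off l) (d l) :: 'a mat) =
      (\<Sum>l\<in>{..<n} - {failed}. d l)"
  using assms by (auto simp: amount_read_def amount_downloaded_def card_nonzero_rows_window
      simp del: dim_window intro!: sum.cong) simp

section \<open>Two copies of a repair scheme\<close>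

text \<open>Block diagonal, so that the base scheme acts on the two halves of a node
  separately.\<close>

definition double_mat :: "'a :: zero mat \<Rightarrow> 'a mat" where
  "double_mat A =
    four_block_mat A (0\<^sub>m (dim_row A) (dim_col A)) (0\<^sub>m (dim_row A) (dim_col A)) A"

lemma dim_double_mat [simp]:
  "dim_row (double_mat A) = 2 * dim_row A" "dim_col (double_mat A) = 2 * dim_col A"
  by (simp_all add: double_mat_def)

lemma vec_mat_mult_double_mat:
  assumes "u \<in> carrier_vec (dim_row A)" "w \<in> carrier_vec (dim_row A)"
  shows "vec_mat_mult (u @\<^sub>v w) (double_mat A) = vec_mat_mult u A @\<^sub>v vec_mat_mult w A"
proof -
  have A: "A \<in> carrier_mat (dim_row A) (dim_col A)" by simp
  have "transpose_mat (double_mat A) = four_block_mat (transpose_mat A)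
      (0\<^sub>m (dim_col A) (dim_row A)) (0\<^sub>m (dim_col A) (dim_row A)) (transpose_mat A)"
    unfolding double_mat_def by (subst transpose_four_block_mat[OF A _ _ A]) auto
  moreover have "transpose_mat A *\<^sub>v u \<in> carrier_vec (dim_col A)"
      "transpose_mat A *\<^sub>v w \<in> carrier_vec (dim_col A)"
    by (auto intro: carrier_vecI)
  moreover have "0\<^sub>m (dim_col A) (dim_row A) *\<^sub>v v = 0\<^sub>v (dim_col A)"
    if "v \<in> carrier_vec (dim_row A)" for v :: "'a vec"
    using that by (intro eq_vecI) (auto simp: scalar_prod_def)
  ultimately show ?thesis
    unfolding vec_mat_mult_def
    using four_block_mat_mult_vec[of "transpose_mat A" "dim_col A" "dim_row A"
        "0\<^sub>m (dim_col A) (dim_row A)" "dim_row A" "0\<^sub>m (dim_col A) (dim_row A)" "dim_col A"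
        "transpose_mat A" u w] assms
    by simp
qed

text \<open>The nonzero rows are those of \<open>A\<close> together with their translates by
  \<open>dim_row A\<close>, and these two sets are disjoint.\<close>

lemma card_nonzero_rows_double_mat:
  "card {t. t < dim_row (double_mat A) \<and> row (double_mat A) t \<noteq> 0\<^sub>v (dim_col (double_mat A))} =
    2 * card {t. t < dim_row A \<and> row A t \<noteq> 0\<^sub>v (dim_col A)}"
    (is "card ?D = 2 * card ?R")
proof -
  let ?d = "dim_row A"
  have nonzero: "row B t \<noteq> 0\<^sub>v (dim_col B) \<longleftrightarrow> (\<exists>c<dim_col B. B $$ (t, c) \<noteq> 0)"
    if "t < dim_row B" for t and B :: "'a mat"
    using that by (auto simp: vec_eq_iff)
  have "?D = ?R \<union> (+) ?d ` ?R"
  proof (intro Set.set_eqI iffI)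
    fix t assume "t \<in> ?D"
    then obtain c where t: "t < 2 * ?d" and c: "c < 2 * dim_col A" "double_mat A $$ (t, c) \<noteq> 0"
      using nonzero[of t "double_mat A"] by auto
    show "t \<in> ?R \<union> (+) ?d ` ?R"
    \<comment> \<open>The off-diagonal blocks vanish, so the column \<open>c\<close> of a nonzero
      entry lies in the same copy of \<open>A\<close> as its row \<open>t\<close>.\<close>
    proof (cases "t < ?d")
      case True
      then have "c < dim_col A \<and> A $$ (t, c) \<noteq> 0"
        using t c by (auto simp: double_mat_def split: if_splits)
      then have "t \<in> ?R" using True nonzero[of t A] by auto
      then show ?thesis by simp
    next
      case False
      then have "c - dim_col A < dim_col A \<and> A $$ (t - ?d, c - dim_col A) \<noteq> 0"
        using t c by (auto simp: double_mat_def split: if_splits)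
      then have "t - ?d \<in> ?R" using False t nonzero[of "t - ?d" A] by auto
      moreover have "t = ?d + (t - ?d)" using False by simp
      ultimately show ?thesis by blast
    qed
  next
    fix t assume "t \<in> ?R \<union> (+) ?d ` ?R"
    then consider "t \<in> ?R" | t' where "t = ?d + t'" "t' \<in> ?R" by blast
    then show "t \<in> ?D"
    proof cases
      case 1
      then obtain c where "t < ?d" "c < dim_col A" "A $$ (t, c) \<noteq> 0"
        using nonzero[of t A] by auto
      then have "c < 2 * dim_col A \<and> double_mat A $$ (t, c) \<noteq> 0" "t < 2 * ?d"
        by (auto simp: double_mat_def)
      then show ?thesis using nonzero[of t "double_mat A"] by auto
    next
      case 2
      then obtain c where "t' < ?d" "c < dim_col A" "A $$ (t', c) \<noteq> 0"
        using nonzero[of t' A] by auto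
      then have "dim_col A + c < 2 * dim_col A \<and> double_mat A $$ (t, dim_col A + c) \<noteq> 0"
          "t < 2 * ?d"
        using 2 by (auto simp: double_mat_def)
      then show ?thesis using nonzero[of t "double_mat A"] by auto
    qed
  qed
  moreover have "?R \<inter> (+) ?d ` ?R = {}" by auto
  ultimately show ?thesis
    by (simp add: card_Un_disjoint card_image)
qed

lemma amount_double_mat:
  "amount_read n failed (\<lambda>l. double_mat (M l)) = 2 * amount_read n failed M"
  "amount_downloaded n failed (\<lambda>l. double_mat (M l)) = 2 * amount_downloaded n failed M"
  unfolding amount_read_def amount_downloaded_def card_nonzero_rows_double_mat
  by (simp_all add: sum_distrib_left)

section \<open>Sums of node contents\<close>

text \<open>This serves as the piggyback. Fixing the length by \<open>vec \<mu>\<close> makes the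
  empty sum the zero vector of the right length, so a node with an empty set carries no
  piggyback.\<close>

definition node_sum :: "nat \<Rightarrow> 'a :: comm_monoid_add code \<Rightarrow> nat set \<Rightarrow> 'a vec \<Rightarrow> 'a vec" where
  "node_sum \<mu> C A a = vec \<mu> (\<lambda>t. \<Sum>l\<in>A. C l a $ t)"

lemma node_sum_carrier [simp]: "node_sum \<mu> C A a \<in> carrier_vec \<mu>"
  by (simp add: node_sum_def)

lemma node_sum_empty [simp]: "node_sum \<mu> C {} a = 0\<^sub>v \<mu>"
  by (auto simp: node_sum_def)

text \<open>By linearity, the image of the sum is the sum of the images: the sums over nodes and
  over symbols are exchanged. Hence the image of a piggyback is known once each summand has been
  passed through the same matrix.\<close>

lemma vec_mat_mult_node_sum_cong:
  fixes C :: "'a :: comm_semiring_0 code"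
  assumes dim: "dim_row A = \<mu>" and C: "\<And>l. l \<in> S \<Longrightarrow> C l a \<in> carrier_vec \<mu> \<and> C l a' \<in> carrier_vec \<mu>"
    and eq: "\<And>l. l \<in> S \<Longrightarrow> vec_mat_mult (C l a) A = vec_mat_mult (C l a') A"
  shows "vec_mat_mult (node_sum \<mu> C S a) A = vec_mat_mult (node_sum \<mu> C S a') A"
proof -
  have swap: "vec_mat_mult (node_sum \<mu> C S x) A = vec (dim_col A) (\<lambda>c. \<Sum>l\<in>S. vec_mat_mult (C l x) A $ c)"
    if "\<And>l. l \<in> S \<Longrightarrow> C l x \<in> carrier_vec \<mu>" for x
  proof (rule eq_vecI)
    fix c assume "c < dim_vec (vec (dim_col A) (\<lambda>c. \<Sum>l\<in>S. vec_mat_mult (C l x) A $ c))"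
    then have c: "c < dim_col A" by simp
    have "vec_mat_mult (node_sum \<mu> C S x) A $ c = (\<Sum>t<\<mu>. \<Sum>l\<in>S. A $$ (t, c) * C l x $ t)"
      using c by (subst index_vec_mat_mult)
        (auto simp: dim node_sum_def sum_distrib_left intro!: sum.cong)
    also have "\<dots> = (\<Sum>l\<in>S. \<Sum>t<\<mu>. A $$ (t, c) * C l x $ t)"
      by (rule sum.swap)
    also have "\<dots> = (\<Sum>l\<in>S. vec_mat_mult (C l x) A $ c)"
      using c that by (intro sum.cong) (auto simp: index_vec_mat_mult dim)
    finally show "vec_mat_mult (node_sum \<mu> C S x) A $ c =
        vec (dim_col A) (\<lambda>c. \<Sum>l\<in>S. vec_mat_mult (C l x) A $ c) $ c"
      using c by simp
  qed simp
  show ?thesis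
    using C eq by (simp add: swap cong: sum.cong)
qed

text \<open>Subtracting the other summands from the sum isolates the contents of
  \<open>f\<close>.\<close>

lemma node_sum_cancel:
  fixes C :: "'a :: ab_group_add code"
  assumes "node_sum \<mu> C S a = node_sum \<mu> C S a'" "finite S" "f \<in> S"
    and "C f a \<in> carrier_vec \<mu>" "C f a' \<in> carrier_vec \<mu>"
    and "\<And>l. l \<in> S - {f} \<Longrightarrow> C l a = C l a'"
  shows "C f a = C f a'"
proof (rule eq_vecI)
  fix t assume "t < dim_vec (C f a')"
  then have "(\<Sum>l\<in>S. C l a $ t) = (\<Sum>l\<in>S. C l a' $ t)"
    using assms(1,5) unfolding node_sum_def by (auto simp: vec_eq_iff)
  moreover have "(\<Sum>l\<in>S - {f}. C l a $ t) = (\<Sum>l\<in>S - {f}. C l a' $ t)"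
    using assms(6) by (intro sum.cong) auto
  ultimately show "C f a $ t = C f a' $ t"
    using assms(2,3) by (simp add: sum.remove)
qed (use assms in auto)

lemma add_vec_right_cancel:
  fixes v w x :: "'a :: ab_group_add vec"
  assumes "v + x = w + x" "v \<in> carrier_vec n" "w \<in> carrier_vec n" "x \<in> carrier_vec n"
  shows "v = w"
proof (rule eq_vecI)
  fix i assume "i < dim_vec w"
  then have "v $ i + x $ i = w $ i + x $ i"
    using assms by (metis carrier_vecD index_add_vec(1))
  then show "v $ i = w $ i" by simp
qed (use assms in simp)

lemma add_vec_left_cancel:
  fixes v w x :: "'a :: ab_group_add vec"
  assumes "x + v = x + w" "v \<in> carrier_vec n" "w \<in> carrier_vec n" "x \<in> carrier_vec n"
  shows "v = w"
  using assms by (metis add_vec_right_cancel comm_add_vec)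

section \<open>Piggybacked codes and the MDS property\<close>

text \<open>Here \<open>d\<close> is the length of one message, so the two halves of
  \<open>m\<close> are the messages of the two instances; only the second instance is
  modified.\<close>

definition piggyback_code ::
  "nat \<Rightarrow> (nat \<Rightarrow> 'a :: plus vec \<Rightarrow> 'a vec) \<Rightarrow> 'a code \<Rightarrow> 'a code" where
  "piggyback_code d p C l m =
     C l (vec_first m d) @\<^sub>v (C l (vec_last m d) + p l (vec_first m d))"

lemma piggyback_code_append [simp]:
  assumes "a \<in> carrier_vec d" "b \<in> carrier_vec d"
  shows "piggyback_code d p C l (a @\<^sub>v b) = C l a @\<^sub>v (C l b + p l a)"
proof -
  have "vec_first (a @\<^sub>v b) d = a" "vec_last (a @\<^sub>v b) d = b"
    using assms by (auto simp: vec_first_def vec_last_def)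
  then show ?thesis by (simp add: piggyback_code_def)
qed

lemma two_instances_cases:
  assumes "m \<in> carrier_vec (k * (2 * \<mu>))"
  obtains a b where "a \<in> carrier_vec (k * \<mu>)" "b \<in> carrier_vec (k * \<mu>)" "m = a @\<^sub>v b"
proof -
  have "k * (2 * \<mu>) = k * \<mu> + k * \<mu>" by simp
  then have "m \<in> carrier_vec (k * \<mu> + k * \<mu>)" using assms by metis
  then show ?thesis using that by (metis vec_first_last_append vec_first_carrier vec_last_carrier)
qed

lemma piggybacked_piggyback_code:
  fixes C :: "'a :: comm_ring_1 code"
  assumes C: "\<And>l m. l < n \<Longrightarrow> m \<in> carrier_vec (k * \<mu>) \<Longrightarrow> C l m \<in> carrier_vec \<mu>"
    and p: "\<And>l a. p l a \<in> carrier_vec \<mu>"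
  shows "piggybacked n k \<mu> C (piggyback_code (k * \<mu>) p C)"
  unfolding piggybacked_def
\<comment> \<open>The data of each node is left untransformed, so the identity matrix serves as
  \<open>T\<close> everywhere.\<close>
proof (intro exI[of _ p] exI[of _ "\<lambda>_. 1\<^sub>m (2 * \<mu>)"] conjI allI impI ballI)
  show "invertible_mat (1\<^sub>m (2 * \<mu>) :: 'a mat)"
    unfolding invertible_mat_def by (auto simp: inverts_mat_def intro!: exI[of _ "1\<^sub>m (2 * \<mu>)"])
next
  fix l and a b :: "'a vec"
  assume "l < n" and ab: "a \<in> carrier_vec (k * \<mu>)" "b \<in> carrier_vec (k * \<mu>)"
  then have "C l a @\<^sub>v (C l b + p l a) \<in> carrier_vec (\<mu> + \<mu>)"
    using C p by (intro append_carrier_vec add_carrier_vec) auto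
  then have "1\<^sub>m (2 * \<mu>) *\<^sub>v (C l a @\<^sub>v (C l b + p l a)) = C l a @\<^sub>v (C l b + p l a)"
    by (intro one_mult_mat_vec) (simp add: mult_2)
  then show "piggyback_code (k * \<mu>) p C l (a @\<^sub>v b) =
      1\<^sub>m (2 * \<mu>) *\<^sub>v (C l a @\<^sub>v (C l b + p l a))"
    using ab by simp
qed (use p in auto)

text \<open>Decoding proceeds one instance after the other, and the piggybacks can be arbitrary
  functions of the first message, linear or not.\<close>

lemma mds_code_piggyback_code:
  fixes C :: "'a :: comm_ring_1 code"
  assumes mds: "mds_code n k \<mu> C" and p: "\<And>l a. p l a \<in> carrier_vec \<mu>"
  shows "mds_code n k (2 * \<mu>) (piggyback_code (k * \<mu>) p C)"
  unfolding mds_code_def recoverable_restrict_iff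
proof (intro conjI allI impI ballI)
  fix l and m :: "'a vec" assume l: "l < n" and "m \<in> carrier_vec (k * (2 * \<mu>))"
  from this(2) obtain a b where ab: "a \<in> carrier_vec (k * \<mu>)" "b \<in> carrier_vec (k * \<mu>)"
    and m: "m = a @\<^sub>v b" by (rule two_instances_cases)
  have "C l a @\<^sub>v (C l b + p l a) \<in> carrier_vec (\<mu> + \<mu>)"
    using mds_code_carrier[OF mds l] ab p by (intro append_carrier_vec add_carrier_vec) auto
  then show "piggyback_code (k * \<mu>) p C l m \<in> carrier_vec (2 * \<mu>)"
    using ab m by (simp add: mult_2)
next
  fix S m m'
  assume S: "S \<subseteq> {..<n} \<and> card S = k"
    and "m \<in> carrier_vec (k * (2 * \<mu>))" "m' \<in> carrier_vec (k * (2 * \<mu>))"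
    and eq: "\<forall>l\<in>S. piggyback_code (k * \<mu>) p C l m = piggyback_code (k * \<mu>) p C l m'"
  from this(2,3) obtain a b a' b' where ab: "a \<in> carrier_vec (k * \<mu>)" "b \<in> carrier_vec (k * \<mu>)"
    "a' \<in> carrier_vec (k * \<mu>)" "b' \<in> carrier_vec (k * \<mu>)"
    and m: "m = a @\<^sub>v b" "m' = a' @\<^sub>v b'" by (metis two_instances_cases)
  have C: "C l x \<in> carrier_vec \<mu>" if "l \<in> S" "x \<in> carrier_vec (k * \<mu>)" for l x
    using mds_code_carrier[OF mds] S that by blast
  have halves: "C l a = C l a' \<and> C l b + p l a = C l b' + p l a'" if "l \<in> S" for l
  proof -
    have "piggyback_code (k * \<mu>) p C l m = piggyback_code (k * \<mu>) p C l m'"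
      using eq that by blast
    then show ?thesis
      using ab append_vec_eq[OF C[OF that ab(1)] C[OF that ab(3)]] by (simp add: m)
  qed
  have "a = a'"
    by (rule mds_code_inj[OF mds, of S]) (use S ab halves in auto)
  \<comment> \<open>With \<open>a = a'\<close> the piggybacks coincide and cancel, leaving the base
    code for the second message.\<close>
  moreover have "b = b'"
  proof (rule mds_code_inj[OF mds, of S])
    fix l assume "l \<in> S"
    then show "C l b = C l b'"
      using halves[of l] \<open>a = a'\<close> C ab p by (metis add_vec_right_cancel)
  qed (use S ab in auto)
  ultimately show "m = m'" by (simp add: m)
qed

section \<open>Repair of systematic nodes\<close>

text \<open>The condition \<open>M l' = M l\<close> is the abstract form of all parities passing the
  same combination: what the nodes of \<open>G l\<close> pass from their first halves adds up to the
  image of the piggyback of \<open>l\<close>. Excluding \<open>i\<close> from \<open>G l\<close>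
  ensures that all these summands come from surviving nodes.\<close>

lemma linear_repair_double_mat:
  fixes C :: "'a :: comm_ring_1 code"
  assumes mds: "mds_code n k \<mu> C" and i: "i < n" and repair: "linear_repair n k \<mu> C i M"
    and Gi: "G i = {}"
    and G: "\<And>l l'. l < n \<Longrightarrow> l' \<in> G l \<Longrightarrow> l' < n \<and> l' \<noteq> i \<and> M l' = M l"
  shows "linear_repair n k (2 * \<mu>) (piggyback_code (k * \<mu>) (\<lambda>l. node_sum \<mu> C (G l)) C) i
    (\<lambda>l. double_mat (M l))"
  unfolding linear_repair_def recoverable_restrict_iff
proof (intro conjI ballI impI)
  fix l assume "l \<in> {..<n} - {i}"
  then show "dim_row (double_mat (M l)) = 2 * \<mu>"
    using repair unfolding linear_repair_def by auto
next
  let ?p = "\<lambda>l. node_sum \<mu> C (G l)"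
  fix m m'
  assume "m \<in> carrier_vec (k * (2 * \<mu>))" "m' \<in> carrier_vec (k * (2 * \<mu>))"
    and eq: "\<forall>l\<in>{..<n} - {i}.
      vec_mat_mult (piggyback_code (k * \<mu>) ?p C l m) (double_mat (M l)) =
      vec_mat_mult (piggyback_code (k * \<mu>) ?p C l m') (double_mat (M l))"
  from this(1,2) obtain a b a' b' where ab: "a \<in> carrier_vec (k * \<mu>)" "b \<in> carrier_vec (k * \<mu>)"
    "a' \<in> carrier_vec (k * \<mu>)" "b' \<in> carrier_vec (k * \<mu>)"
    and m: "m = a @\<^sub>v b" "m' = a' @\<^sub>v b'" by (metis two_instances_cases)
  have C: "C l x \<in> carrier_vec \<mu>" if "l < n" "x \<in> carrier_vec (k * \<mu>)" for l x
    using mds_code_carrier[OF mds] that by blast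
  have dim: "dim_row (M l) = \<mu>" if "l < n" "l \<noteq> i" for l
    using repair that unfolding linear_repair_def by auto
  let ?X = "\<lambda>l x. vec_mat_mult (C l x) (M l)" and ?Y = "\<lambda>l x. vec_mat_mult (?p l x) (M l)"
  have carr: "?X l x \<in> carrier_vec (dim_col (M l))" "?Y l x \<in> carrier_vec (dim_col (M l))" for l x
    by (auto intro: carrier_vecI)
  have halves: "?X l a = ?X l a' \<and> ?X l b + ?Y l a = ?X l b' + ?Y l a'" if l: "l < n" "l \<noteq> i" for l
  proof -
    have img: "vec_mat_mult (piggyback_code (k * \<mu>) ?p C l (x @\<^sub>v y)) (double_mat (M l)) =
        ?X l x @\<^sub>v (?X l y + ?Y l x)"
      if "x \<in> carrier_vec (k * \<mu>)" "y \<in> carrier_vec (k * \<mu>)" for x y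
      using that C l dim[OF l] by (simp add: vec_mat_mult_double_mat vec_mat_mult_add)
    have "vec_mat_mult (piggyback_code (k * \<mu>) ?p C l m) (double_mat (M l)) =
        vec_mat_mult (piggyback_code (k * \<mu>) ?p C l m') (double_mat (M l))"
      using eq l by blast
    then show ?thesis
      unfolding m img[OF ab(1,2)] img[OF ab(3,4)]
      using append_vec_eq[OF carr(1)[of l a] carr(1)[of l a']] by blast
  qed
  have "C i a = C i a'"
    by (rule linear_repair_inj[OF repair]) (use ab halves in auto)
  moreover have "C i b = C i b'"
  proof (rule linear_repair_inj[OF repair])
    fix l assume l: "l < n" "l \<noteq> i"
    \<comment> \<open>The first halves show \<open>C l' a\<close> under \<open>M l'\<close>, which
      is the matrix \<open>M l\<close> applied to the piggyback; linearity does the rest.\<close>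
    have "?Y l a = ?Y l a'"
    proof (rule vec_mat_mult_node_sum_cong[OF dim[OF l]])
      fix l' assume "l' \<in> G l"
      with G[OF l(1)] have l': "l' < n" "l' \<noteq> i" "M l' = M l" by auto
      show "C l' a \<in> carrier_vec \<mu> \<and> C l' a' \<in> carrier_vec \<mu>" using C l' ab by blast
      show "vec_mat_mult (C l' a) (M l) = vec_mat_mult (C l' a') (M l)"
        using halves[OF l'(1,2)] l'(3) by simp
    qed
    then show "?X l b = ?X l b'"
      using halves[OF l] carr by (metis add_vec_right_cancel)
  qed (use ab in auto)
  ultimately show "piggyback_code (k * \<mu>) ?p C i m = piggyback_code (k * \<mu>) ?p C i m'"
    using ab C i Gi by (simp add: m)
qed

section \<open>Repair of parity nodes\<close>

text \<open>Any \<open>k\<close> nodes read in full give the whole message by the MDS property. This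
  is how the heads of the groups are repaired.\<close>

lemma linear_repair_read_all:
  fixes C :: "'a :: comm_ring_1 code"
  assumes mds: "mds_code n k (2 * \<mu>) C" and K: "K \<subseteq> {..<n}" "card K = k" and f: "f \<notin> K"
  shows "linear_repair n k (2 * \<mu>) C f
    (\<lambda>l. window (2 * \<mu>) 0 (if l \<in> K then 2 * \<mu> else 0))"
  unfolding linear_repair_def recoverable_restrict_iff
proof (intro conjI ballI impI)
  fix m m'
  assume m: "m \<in> carrier_vec (k * (2 * \<mu>))" "m' \<in> carrier_vec (k * (2 * \<mu>))"
    and eq: "\<forall>l\<in>{..<n} - {f}.
      vec_mat_mult (C l m) (window (2 * \<mu>) 0 (if l \<in> K then 2 * \<mu> else 0)) =
      vec_mat_mult (C l m') (window (2 * \<mu>) 0 (if l \<in> K then 2 * \<mu> else 0))"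
  have "m = m'"
  proof (rule mds_code_inj[OF mds K m])
    fix l assume l: "l \<in> K"
    have id: "vec_mat_mult (C l x) (window (2 * \<mu>) 0 (2 * \<mu>)) = C l x"
      if "x \<in> carrier_vec (k * (2 * \<mu>))" for x
    proof -
      have "C l x \<in> carrier_vec (2 * \<mu>)" using mds_code_carrier[OF mds _ that] K(1) l by blast
      then show ?thesis by (subst vec_mat_mult_window) auto
    qed
    have "l \<in> {..<n} - {f}" using l K(1) f by blast
    then have "vec_mat_mult (C l m) (window (2 * \<mu>) 0 (2 * \<mu>)) =
        vec_mat_mult (C l m') (window (2 * \<mu>) 0 (2 * \<mu>))"
      using eq l by force
    then show "C l m = C l m'" using id m by simp
  qed
  then show "C f m = C f m'" by simp
qed simp

text \<open>Here \<open>h\<close> is the head of the group of \<open>f\<close>. The nodes of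
  \<open>K\<close> have no piggyback, so their second halves yield \<open>b\<close>. Removing the
  base symbols for \<open>b\<close> from the second half of \<open>h\<close> exposes the sum over
  \<open>G h\<close>, from which the first halves of the other members are subtracted.\<close>

lemma linear_repair_group_member:
  fixes C :: "'a :: comm_ring_1 code"
  assumes mds: "mds_code n k \<mu> C" and K: "K \<subseteq> {..<n}" "card K = k" and f: "f \<notin> K" "f \<in> G h"
    and h: "h < n" "h \<notin> G h" and G: "G h \<subseteq> {..<n}" "G h \<inter> K = {}"
    and Gf: "G f = {}" and GK: "\<And>l. l \<in> K \<Longrightarrow> G l = {}"
  shows "linear_repair n k (2 * \<mu>) (piggyback_code (k * \<mu>) (\<lambda>l. node_sum \<mu> C (G l)) C) f
    (\<lambda>l. window (2 * \<mu>) (if l \<in> G h then 0 else \<mu>) (if l \<in> K \<union> insert h (G h) then \<mu> else 0))"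
    (is "linear_repair _ _ _ ?C _ (\<lambda>l. window _ (?off l) (?d l))")
  unfolding linear_repair_def recoverable_restrict_iff
proof (intro conjI ballI impI)
  let ?p = "\<lambda>l. node_sum \<mu> C (G l)"
  fix m m'
  assume "m \<in> carrier_vec (k * (2 * \<mu>))" "m' \<in> carrier_vec (k * (2 * \<mu>))"
    and eq: "\<forall>l\<in>{..<n} - {f}. vec_mat_mult (?C l m) (window (2 * \<mu>) (?off l) (?d l)) =
      vec_mat_mult (?C l m') (window (2 * \<mu>) (?off l) (?d l))"
  from this(1,2) obtain a b a' b' where ab: "a \<in> carrier_vec (k * \<mu>)" "b \<in> carrier_vec (k * \<mu>)"
    "a' \<in> carrier_vec (k * \<mu>)" "b' \<in> carrier_vec (k * \<mu>)"
    and m: "m = a @\<^sub>v b" "m' = a' @\<^sub>v b'" by (metis two_instances_cases)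
  have C: "C l x \<in> carrier_vec \<mu>" if "l < n" "x \<in> carrier_vec (k * \<mu>)" for l x
    using mds_code_carrier[OF mds] that by blast
  have first_half: "C l a = C l a'" if l: "l \<in> G h" "l \<noteq> f" for l
  proof -
    have l': "l \<in> {..<n} - {f}" using l G by blast
    then have "vec_mat_mult (?C l m) (window (2 * \<mu>) 0 \<mu>) =
        vec_mat_mult (?C l m') (window (2 * \<mu>) 0 \<mu>)"
      using eq l by force
    then show ?thesis
      using ab C l' by (simp add: m vec_mat_mult_window_append)
  qed
  have second_half: "C l b + ?p l a = C l b' + ?p l a'" if l: "l \<in> K \<union> {h}" for l
  proof -
    have l': "l \<in> {..<n} - {f}" "l \<notin> G h" using l G h f K by auto
    then have "vec_mat_mult (?C l m) (window (2 * \<mu>) \<mu> \<mu>) =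
        vec_mat_mult (?C l m') (window (2 * \<mu>) \<mu> \<mu>)"
      using eq l by force
    then show ?thesis
      using ab C l' by (simp add: m vec_mat_mult_window_append)
  qed
  have "b = b'"
  proof (rule mds_code_inj[OF mds K ab(2,4)])
    fix l assume l: "l \<in> K"
    then have "l < n" using K by blast
    then show "C l b = C l b'" using second_half[of l] GK[OF l] C ab l by auto
  qed
  \<comment> \<open>Since \<open>b = b'\<close>, the base symbols of the head in the second instance
    agree and cancel.\<close>
  then have "?p h a = ?p h a'"
    by (intro add_vec_left_cancel[of "C h b'" "?p h a" "?p h a'" \<mu>])
      (use second_half[of h] C[OF h(1) ab(4)] in auto)
  moreover have "finite (G h)" using G(1) finite_subset by blast
  moreover have "C f a \<in> carrier_vec \<mu>" "C f a' \<in> carrier_vec \<mu>" using f G C ab by blast+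
  ultimately have "C f a = C f a'"
    using node_sum_cancel[of \<mu> C "G h" a a' f] f first_half by blast
  \<comment> \<open>The node \<open>f\<close> has an empty piggyback, so its contents are determined
    by \<open>C f a\<close> and \<open>b\<close>.\<close>
  then show "?C f m = ?C f m'"
    using ab \<open>b = b'\<close> Gf by (simp add: m)
qed simp

section \<open>Groups of parities and the average cost\<close>

text \<open>The multiples of \<open>s\<close> below \<open>g * s\<close> are the \<open>g\<close>
  heads, of cost \<open>x\<close>; each of the \<open>g\<close> groups has \<open>s - 1\<close>
  further members, of cost \<open>y\<close>.\<close>

lemma sum_if_dvd:
  assumes "s > 0"
  shows "(\<Sum>j<g * s. if s dvd j then x else y) = real g * x + real (g * (s - 1)) * y"
proof -
  have "(\<Sum>j<g * s. if s dvd j then x else y) =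
      real (card ({..<g * s} \<inter> {j. s dvd j})) * x + real (card ({..<g * s} \<inter> - {j. s dvd j})) * y"
    by (simp add: sum.If_cases)
  moreover have "{..<g * s} \<inter> {j. s dvd j} = (\<lambda>i. i * s) ` {..<g}"
    using assms by (auto simp: dvd_def image_iff mult.commute)
  then have card_heads: "card ({..<g * s} \<inter> {j. s dvd j}) = g"
    using assms by (simp add: card_image inj_on_def)
  moreover have "card ({..<g * s} \<inter> - {j. s dvd j}) = g * (s - 1)"
    using card_Int_Diff[of "{..<g * s}" "{j. s dvd j}"] card_heads
    by (simp add: Diff_eq algebra_simps)
  ultimately show ?thesis by simp
qed

theorem mainTheorem7:
  fixes k r \<mu> g :: nat
    and P :: "nat \<Rightarrow> 'a :: {finite, field} mat"
    and M :: "nat \<Rightarrow> nat \<Rightarrow> 'a mat"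
    and Q :: "nat \<Rightarrow> 'a mat"
  assumes "k \<ge> 1" and "\<mu> \<ge> 1"
    and "\<forall>j<r. P j \<in> carrier_mat (k * \<mu>) \<mu>"
    and "mds_code (k + r) k \<mu> (systematic_code k \<mu> P)"
    and "\<forall>i<k. linear_repair (k + r) k \<mu> (systematic_code k \<mu> P) i (M i)"
    and "\<forall>i<k. \<forall>j<r. M i (k + j) = Q i"
    and "g = nat \<lfloor>real r / sqrt (real (k + 1))\<rfloor>"
    and "g \<ge> 1" and "g dvd r"
  shows "\<exists>C. piggybacked (k + r) k \<mu> (systematic_code k \<mu> P) C \<and>
    mds_code (k + r) k (2 * \<mu>) C \<and>
    (\<forall>i<k. \<exists>N. linear_repair (k + r) k (2 * \<mu>) C i N \<and>
       amount_read (k + r) i N = 2 * amount_read (k + r) i (M i) \<and>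
       amount_downloaded (k + r) i N = 2 * amount_downloaded (k + r) i (M i)) \<and>
    (\<exists>N. (\<forall>j<r. linear_repair (k + r) k (2 * \<mu>) C (k + j) (N j)) \<and>
       (\<Sum>j<r. real (amount_read (k + r) (k + j) (N j))) / real r / real (2 * k * \<mu>) =
         1 / 2 + (real k + (real r / real g - 1)\<^sup>2) / (2 * real k * (real r / real g)) \<and>
       (\<Sum>j<r. real (amount_downloaded (k + r) (k + j) (N j))) / real r / real (2 * k * \<mu>) =
         1 / 2 + (real k + (real r / real g - 1)\<^sup>2) / (2 * real k * (real r / real g)))"
proof -
  let ?B = "systematic_code k \<mu> P"
  note mds = assms(4)
  define s where "s = r div g"
  have r: "r = g * s" using assms(9) by (simp add: s_def)
  \<comment> \<open>For \<open>r = 0\<close> the formula for \<open>g\<close> would give 0.\<close>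
  have "r > 0"
    using assms(7,8) by (cases "r = 0") auto
  then have s: "s > 0" using r by (cases s) auto
  \<comment> \<open>For a head \<open>l\<close> this is its group without \<open>l\<close> itself;
    all other nodes get the empty set. The guard \<open>k \<le> l\<close> matters: for systematic
    nodes the truncated difference \<open>l - k\<close> is 0, which \<open>s\<close>
    divides.\<close>
  define G where "G l = (if k \<le> l \<and> s dvd l - k then {l<..<l + s} else {})" for l
  define C where "C = piggyback_code (k * \<mu>) (\<lambda>l. node_sum \<mu> ?B (G l)) ?B"
  have G_bounds: "k < l' \<and> l' < k + r" if l: "l < k + r" "l' \<in> G l" for l l'
  proof -
    have *: "k \<le> l" "s dvd l - k" "l < l'" "l' < l + s"
      using l by (auto simp: G_def split: if_splits)
    \<comment> \<open>The last group does not run past the parities: \<open>r - (l - k)\<close> is a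
      positive multiple of \<open>s\<close>, hence at least \<open>s\<close>.\<close>
    have "l - k + s \<le> r"
    proof -
      have "s dvd r - (l - k)" using * by (simp add: r dvd_diff_nat del: diff_diff_right)
      then have "s \<le> r - (l - k)" using * l by (intro dvd_imp_le) auto
      then show ?thesis using l * by linarith
    qed
    then show ?thesis using * by linarith
  qed
  have mdsC: "mds_code (k + r) k (2 * \<mu>) C"
    unfolding C_def by (rule mds_code_piggyback_code[OF mds]) simp
  have pig: "piggybacked (k + r) k \<mu> ?B C"
    unfolding C_def
    by (rule piggybacked_piggyback_code) (auto intro: mds_code_carrier[OF mds])
  have systematic: "linear_repair (k + r) k (2 * \<mu>) C i (\<lambda>l. double_mat (M i l))" if i: "i < k" for i
    unfolding C_def
  proof (rule linear_repair_double_mat[OF mds])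
    show "linear_repair (k + r) k \<mu> ?B i (M i)" using assms(5) i by blast
    show "G i = {}" using i by (simp add: G_def)
    fix l l' assume l: "l < k + r" "l' \<in> G l"
    have parity: "M i x = Q i" if x: "k \<le> x" "x < k + r" for x
    proof -
      have "M i (k + (x - k)) = Q i"
        by (rule assms(6)[rule_format]) (use i x in auto)
      then show ?thesis using x by simp
    qed
    have "k \<le> l" using l by (auto simp: G_def split: if_splits)
    then have "M i l' = M i l"
      using parity G_bounds[OF l] l(1) by simp
    then show "l' < k + r \<and> l' \<noteq> i \<and> M i l' = M i l"
      using G_bounds[OF l] i by simp
  qed (use i in simp)
  \<comment> \<open>Rounding \<open>j\<close> down to a multiple of \<open>s\<close> gives the head
    of its group.\<close>
  define head where "head j = k + (j - j mod s)" for j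
  \<comment> \<open>If \<open>j\<close> is a head, the systematic nodes are taken whole. Otherwise
    the window is the first half at the members of \<open>G (head j)\<close>, and the second half at
    the systematic nodes and the head.\<close>
  define off where "off j l = (if s dvd j then 0 else if l \<in> G (head j) then 0 else \<mu>)" for j l
  define d where "d j l = (if s dvd j then if l \<in> {..<k} then 2 * \<mu> else 0
    else if l \<in> {..<k} \<union> insert (head j) (G (head j)) then \<mu> else 0)" for j l
  define N :: "nat \<Rightarrow> nat \<Rightarrow> 'a mat" where "N j l = window (2 * \<mu>) (off j l) (d j l)" for j l
  have head: "s dvd head j - k" "k \<le> head j" "G (head j) = {head j<..<head j + s}" for j
    by (auto simp: head_def G_def minus_mod_eq_mult_div)
  have head_less: "head j < k + j" "k + j \<in> G (head j)" if "\<not> s dvd j" for j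
  proof -
    have "j mod s > 0" "j mod s < s" "j mod s \<le> j" using that s by (auto simp: dvd_eq_mod_eq_0)
    then have "head j < k + j" "k + j < head j + s"
      unfolding head_def by linarith+
    then show "head j < k + j" "k + j \<in> G (head j)"
      unfolding head(3) by auto
  qed
  have parity: "linear_repair (k + r) k (2 * \<mu>) C (k + j) (N j)" if j: "j < r" for j
  proof (cases "s dvd j")
    case True
    then show ?thesis
      using linear_repair_read_all[OF mdsC, of "{..<k}" "k + j"]
      by (simp add: N_def[abs_def] off_def d_def subset_iff)
  next
    case False
    have bounds: "k < l \<and> l < k + r" if "l \<in> G (head j)" for l
      using that G_bounds[of "head j" l] head_less(1)[OF False] j by simp
    have "linear_repair (k + r) k (2 * \<mu>) C (k + j)
      (\<lambda>l. window (2 * \<mu>) (if l \<in> G (head j) then 0 else \<mu>)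
        (if l \<in> {..<k} \<union> insert (head j) (G (head j)) then \<mu> else 0))"
      unfolding C_def
    proof (rule linear_repair_group_member[OF mds])
      show "head j < k + r" using head_less(1)[OF False] j by simp
      show "head j \<notin> G (head j)" by (simp add: head(3))
      show "G (k + j) = {}" using False by (simp add: G_def)
      show "G (head j) \<subseteq> {..<k + r}" "G (head j) \<inter> {..<k} = {}" using bounds by force+
    qed (use head_less(2)[OF False] in \<open>auto simp: G_def\<close>)
    then show ?thesis
      using False by (simp add: N_def[abs_def] off_def d_def)
  qed
  have sum_const: "(\<Sum>l\<in>{..<k + r} - {k + j}. if l \<in> B then c else 0) =
      card (({..<k + r} - {k + j}) \<inter> B) * c" for j c :: nat and B
    by (simp flip: sum.inter_restrict)
  have amount: "(\<Sum>l\<in>{..<k + r} - {k + j}. d j l) =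
      (if s dvd j then 2 * k * \<mu> else (k + s - 1) * \<mu>)" if j: "j < r" for j
  proof (cases "s dvd j")
    case True
    have "({..<k + r} - {k + j}) \<inter> {..<k} = {..<k}" by auto
    then show ?thesis using True
      unfolding d_def by (simp only: if_True sum_const) simp
  next
    case False
    let ?h = "head j"
    have bounds: "k < l \<and> l < k + r" if "l \<in> G ?h" for l
      using that G_bounds[of ?h l] head_less(1)[OF False] j by simp
    \<comment> \<open>The survivors that contribute are the systematic nodes and the whole group,
      head included, minus the failed parity. This accounts for the \<open>k + s - 1\<close>
      half-nodes.\<close>
    have "({..<k + r} - {k + j}) \<inter> ({..<k} \<union> insert ?h (G ?h)) =
        {..<k} \<union> ({?h..<?h + s} - {k + j})"
    proof (rule Set.set_eqI)
      fix l
      have mem: "l \<in> G ?h \<longleftrightarrow> ?h < l \<and> l < ?h + s" by (simp add: head(3))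
      show "l \<in> ({..<k + r} - {k + j}) \<inter> ({..<k} \<union> insert ?h (G ?h)) \<longleftrightarrow>
          l \<in> {..<k} \<union> ({?h..<?h + s} - {k + j})"
      proof (cases "l < k \<or> l = ?h")
        case True
        then show ?thesis using head_less(1)[OF False] j s by auto
      next
        case False
        then show ?thesis using bounds[of l] mem by auto
      qed
    qed
    moreover have "card ({..<k} \<union> ({?h..<?h + s} - {k + j})) = k + (s - 1)"
    proof -
      have "{..<k} \<inter> ({?h..<?h + s} - {k + j}) = {}" using head(2)[of j] by fastforce
      moreover have "k + j \<in> {?h..<?h + s}" using head_less[OF False] unfolding head(3) by simp
      ultimately show ?thesis by (simp add: card_Un_disjoint card_Diff_singleton)
    qed
    ultimately show ?thesis using False s
      unfolding d_def by (simp only: if_False sum_const) simp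
  qed
  have fits: "off j l + d j l \<le> 2 * \<mu>" for j l by (simp add: off_def d_def)
  have amounts: "amount_read (k + r) (k + j) (N j) = (if s dvd j then 2 * k * \<mu> else (k + s - 1) * \<mu>)"
      "amount_downloaded (k + r) (k + j) (N j) = (if s dvd j then 2 * k * \<mu> else (k + s - 1) * \<mu>)"
    if "j < r" for j
    unfolding N_def[abs_def] amount_window[of "k + r" "off j" "d j", OF fits] amount[OF that]
    by (rule refl)+
  have total: "(\<Sum>j<r. real (if s dvd j then 2 * k * \<mu> else (k + s - 1) * \<mu>)) =
      real g * (2 * k * \<mu>) + real (g * (s - 1)) * ((k + s - 1) * \<mu>)"
    unfolding r using sum_if_dvd[OF s, where x = "real (2 * k * \<mu>)" and y = "real ((k + s - 1) * \<mu>)"]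
    by (simp add: if_distrib[of real])
  \<comment> \<open>With \<open>r = g * s\<close> the left side is
    \<open>(2 * k + (s - 1) * (k + s - 1)) / (2 * k * s)\<close>. Its numerator equals
    \<open>k * s + k + (s - 1)^2\<close>, and the first summand contributes the 1/2.\<close>
  have average: "(real g * (2 * k * \<mu>) + real (g * (s - 1)) * ((k + s - 1) * \<mu>)) / r / (2 * k * \<mu>) =
      1 / 2 + (real k + (real r / real g - 1)\<^sup>2) / (2 * real k * (real r / real g))"
  proof -
    have pos: "real g > 0" "real s > 0" "real k > 0" "real \<mu> > 0"
      using assms(1,2,8) s by simp_all
    have "real (s - 1) = real s - 1" "real (k + s - 1) = real k + real s - 1" using s by auto
    then show ?thesis
      using pos unfolding r
      by (simp add: field_simps power2_eq_square)
  qed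
  have "(\<Sum>j<r. real (amount_read (k + r) (k + j) (N j))) / real r / real (2 * k * \<mu>) =
         1 / 2 + (real k + (real r / real g - 1)\<^sup>2) / (2 * real k * (real r / real g))"
      "(\<Sum>j<r. real (amount_downloaded (k + r) (k + j) (N j))) / real r / real (2 * k * \<mu>) =
         1 / 2 + (real k + (real r / real g - 1)\<^sup>2) / (2 * real k * (real r / real g))"
    unfolding average[symmetric] total[symmetric]
    by (auto simp: amounts simp del: of_nat_mult intro!: sum.cong)
  then show ?thesis
    using pig mdsC systematic parity amount_double_mat by blast
qed

end
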